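(* Let $\mathcal{H}_1$ and $\mathcal{H}_2$ be Hilbert spaces and, for $i=1,2$, let $T_i$ be an unbounded self-adjoint operator on $\mathcal{H}_i$. Suppose that there exist linear isometries $U_1:\mathcal{H}_1\to\mathcal{H}_2$ and $U_2:\mathcal{H}_2\to\mathcal{H}_1$ (not assumed surjective) such that $U_1T_1\subseteq T_2U_1$ and $U_2T_2\subseteq T_1U_2$. Then there is a unitary transformation $U:\mathcal{H}_1\to\mathcal{H}_2$ such that $UT_1U^{-1}=T_2$.
   Context: Hilbert spaces are over $\mathbb{C}$. An unbounded self-adjoint operator $T$ on $\mathcal{H}$ is a linear map defined on a dense linear subspace $D(T)\subseteq\mathcal{H}$ with values in $\mathcal{H}$ such that $T=T^*$ (including equality of domains). For partially defined operators, $A\subseteq B$ means that $D(A)\subseteq D(B)$ and $Ax=Bx$ for all $x\in D(A)$; compositions have their natural domains. Thus $U_1T_1\subseteq T_2U_1$ means that for all $x\in D(T_1)$ one has $U_1x\in D(T_2)$ and $T_2U_1x=U_1T_1x$, and similarly for $U_2T_2\subseteq T_1U_2$. The equality $UT_1U^{-1}=T_2$ includes equality of domains, i.e. $U(D(T_1))=D(T_2)$. A unitary transformation is a surjective linear isometry between Hilbert spaces. *)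

theory Defs
  imports "HOL-Analysis.Analysis"
begin

class complex_vector = real_vector +
  fixes scaleC :: "complex \<Rightarrow> 'a \<Rightarrow> 'a" (infixr \<open>*\<^sub>C\<close> 75)
  assumes scaleC_add_right: "c *\<^sub>C (x + y) = c *\<^sub>C x + c *\<^sub>C y"
    and scaleC_add_left: "(c + d) *\<^sub>C x = c *\<^sub>C x + d *\<^sub>C x"
    and scaleC_scaleC: "c *\<^sub>C (d *\<^sub>C x) = (c * d) *\<^sub>C x"
    and scaleC_one: "1 *\<^sub>C x = x"
    and scaleR_scaleC: "r *\<^sub>R x = complex_of_real r *\<^sub>C x"

global_interpretation complex_vector:
  vector_space "scaleC :: complex \<Rightarrow> 'a \<Rightarrow> 'a::complex_vector"
  by unfold_locales (fact scaleC_add_right scaleC_add_left scaleC_scaleC scaleC_one)+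

text \<open>
  The inner product is conjugate-linear in the first argument and linear in the second.
  Definiteness follows from the last axiom.
\<close>

class complex_inner = complex_vector + real_normed_vector +
  fixes cinner :: "'a \<Rightarrow> 'a \<Rightarrow> complex"
  assumes cinner_commute: "cinner x y = cnj (cinner y x)"
    and cinner_add_right: "cinner x (y + z) = cinner x y + cinner x z"
    and cinner_scaleC_right: "cinner x (c *\<^sub>C y) = c * cinner x y"
    and cinner_ge_zero: "0 \<le> Re (cinner x x)"
    and norm_eq_sqrt_cinner: "norm x = sqrt (Re (cinner x x))"

class chilbert_space = complex_inner + complete_space

definition linear_isometry :: "('a::complex_inner \<Rightarrow> 'b::complex_inner) \<Rightarrow> bool" where
  "linear_isometry U \<longleftrightarrow>
     Vector_Spaces.linear (*\<^sub>C) (*\<^sub>C) U \<and> (\<forall>x. norm (U x) = norm x)"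

definition unitary_transformation :: "('a::complex_inner \<Rightarrow> 'b::complex_inner) \<Rightarrow> bool" where
  "unitary_transformation U \<longleftrightarrow> linear_isometry U \<and> surj U"

text \<open>
  A partially defined operator is a partial function \<open>'a \<rightharpoonup> 'b\<close>, with \<open>dom T\<close> as its domain.
  Hence \<open>(\<subseteq>\<^sub>m)\<close> is extension of operators, \<open>(\<circ>\<^sub>m)\<close> is composition on the natural domain, and
  \<open>(=)\<close> includes equality of domains. An everywhere defined \<open>U\<close> becomes \<open>Some \<circ> U\<close>.
\<close>

definition linear_operator :: "('a::complex_vector \<rightharpoonup> 'b::complex_vector) \<Rightarrow> bool" where
  "linear_operator T \<longleftrightarrow>
     complex_vector.subspace (dom T) \<and>
     (\<forall>x\<in>dom T. \<forall>y\<in>dom T. the (T (x + y)) = the (T x) + the (T y)) \<and>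
     (\<forall>c. \<forall>x\<in>dom T. the (T (c *\<^sub>C x)) = c *\<^sub>C the (T x))"

text \<open>
  The vector \<open>z = T\<^sup>* y\<close> is unique when \<open>dom T\<close> is dense; the definition is meaningful
  only in that case.
\<close>

definition adjoint_operator ::
    "('a::complex_inner \<rightharpoonup> 'b::complex_inner) \<Rightarrow> ('b \<rightharpoonup> 'a)" where
  "adjoint_operator T y =
     (if \<exists>z. \<forall>x\<in>dom T. cinner y (the (T x)) = cinner z x
      then Some (THE z. \<forall>x\<in>dom T. cinner y (the (T x)) = cinner z x)
      else None)"

definition self_adjoint_operator :: "('a::complex_inner \<rightharpoonup> 'a) \<Rightarrow> bool" where
  "self_adjoint_operator T \<longleftrightarrow>
     linear_operator T \<and> closure (dom T) = UNIV \<and> T = adjoint_operator T"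

end

theory Submission
  imports Defs
begin

text \<open>
  The argument is the Cantor--Bernstein construction, carried out with bounded operators.
  Put \<open>V = U\<^sub>2 U\<^sub>1\<close>, an isometry of the first space into itself, and let
  \<open>E = 1 - U\<^sub>2 U\<^sub>2\<^sup>*\<close> be the projection onto the orthogonal complement of the range of \<open>U\<^sub>2\<close>.
  This complement is wandering for \<open>V\<close>: its images under the powers of \<open>V\<close> are mutually
  orthogonal, since \<open>V\<close> maps into the range of \<open>U\<^sub>2\<close>. Let \<open>P = \<Sum>\<^sub>k V\<^sup>k E V\<^sup>*\<^sup>k\<close> be the projection onto
  the sum of these images. As in the Cantor--Bernstein theorem, \<open>U\<^sub>1\<close> is used on the range of \<open>P\<close>
  and the inverse of \<open>U\<^sub>2\<close> on its complement, which lies in the range of \<open>U\<^sub>2\<close>: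
  \<open>U = U\<^sub>1 P + U\<^sub>2\<^sup>* (1 - P)\<close>. That \<open>P U\<^sub>1\<^sup>* + (1 - P) U\<^sub>2\<close> is a two-sided inverse of \<open>U\<close> follows
  algebraically from \<open>P\<^sup>2 = P\<close>, \<open>V P = P V\<close>, \<open>E P = E\<close> and \<open>P = E + V P V\<^sup>*\<close>.

  It remains to see that \<open>U\<close> and its inverse intertwine \<open>T\<^sub>1\<close> and \<open>T\<^sub>2\<close>, domains included. For
  self-adjoint operators, intertwining passes to adjoints (\<open>intertwines_adjoint\<close>), because
  membership in the domain of \<open>T = T\<^sup>*\<close> can be tested by inner products; it clearly passes to
  sums and products; and it passes to strong limits (\<open>intertwines_limit\<close>), because \<open>T\<close> is
  closed. Hence \<open>P\<close> commutes with \<open>T\<^sub>1\<close>, and \<open>U\<close> and \<open>U\<^sup>*\<close> are intertwining.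
\<close>

section \<open>Complex inner product spaces\<close>

lemma cinner_add_left: "cinner (x + y) z = cinner x z + cinner y z"
  by (metis cinner_add_right cinner_commute complex_cnj_add)

lemma cinner_scaleC_left: "cinner (c *\<^sub>C x) y = cnj c * cinner x y"
  by (metis cinner_commute cinner_scaleC_right complex_cnj_mult)

lemma cinner_zero_right [simp]: "cinner x 0 = 0"
  using cinner_add_right[of x 0 0] by simp

lemma cinner_zero_left [simp]: "cinner 0 x = 0"
  using cinner_add_left[of 0 0 x] by simp

lemma cinner_diff_right: "cinner x (y - z) = cinner x y - cinner x z"
  using cinner_add_right[of x "y - z" z] by simp

lemma cinner_diff_left: "cinner (x - y) z = cinner x z - cinner y z"
  using cinner_add_left[of "x - y" y z] by simp

lemma cinner_self: "cinner x x = of_real ((norm x)\<^sup>2)"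
proof -
  have "Im (cinner x x) = 0"
    using cinner_commute[of x x] by (simp add: complex_eq_iff)
  then show ?thesis
    by (simp add: complex_eq_iff norm_eq_sqrt_cinner cinner_ge_zero)
qed

lemma norm_square_eq_Re_cinner: "(norm x)\<^sup>2 = Re (cinner x x)"
  by (simp add: cinner_self)

lemma cinner_ext:
  assumes "\<And>z. cinner z x = cinner z y"
  shows "x = y"
proof -
  have "cinner (x - y) (x - y) = 0"
    using assms by (simp add: cinner_diff_right)
  then show ?thesis
    by (simp add: cinner_self)
qed

text \<open>
  The subtracted vector is the component of \<open>y\<close> along \<open>x\<close>. The identity also covers \<open>x = 0\<close>, where
  both quotients are \<open>0\<close>.
\<close>

lemma norm_minus_component:
  "(norm (y - (cinner x y / of_real ((norm x)\<^sup>2)) *\<^sub>C x))\<^sup>2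
     = (norm y)\<^sup>2 - (cmod (cinner x y))\<^sup>2 / (norm x)\<^sup>2"
proof (cases "x = 0")
  case True
  then show ?thesis by simp
next
  case False
  define c where "c = cinner x y / of_real ((norm x)\<^sup>2)"
  have c: "c * of_real ((norm x)\<^sup>2) = cinner x y"
    using False by (simp add: c_def)
  have "cinner (y - c *\<^sub>C x) (y - c *\<^sub>C x)
      = cinner y y - c * cinner y x - cnj c * cinner x y + cnj c * (c * cinner x x)"
    by (simp add: cinner_diff_left cinner_diff_right cinner_scaleC_left cinner_scaleC_right
        algebra_simps)
  also have "c * cinner x x = cinner x y"
    using c by (simp add: cinner_self)
  also have "cinner y x = cnj (cinner x y)"
    by (rule cinner_commute)
  finally have "cinner (y - c *\<^sub>C x) (y - c *\<^sub>C x) = cinner y y - c * cnj (cinner x y)"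
    by simp
  also have "c * cnj (cinner x y) = of_real ((cmod (cinner x y))\<^sup>2 / (norm x)\<^sup>2)"
    unfolding c_def of_real_divide complex_norm_square by simp
  finally show ?thesis
    by (simp add: norm_square_eq_Re_cinner c_def)
qed

lemma cinner_Cauchy_Schwarz: "cmod (cinner x y) \<le> norm x * norm y"
proof (cases "x = 0")
  case False
  have "0 \<le> (norm y)\<^sup>2 - (cmod (cinner x y))\<^sup>2 / (norm x)\<^sup>2"
    unfolding norm_minus_component[symmetric] by simp
  then have "(cmod (cinner x y))\<^sup>2 \<le> (norm x * norm y)\<^sup>2"
    using False by (simp add: field_simps power_mult_distrib)
  then show ?thesis
    by (rule power2_le_imp_le) simp
qed simp

lemma bounded_linear_cinner_right: "bounded_linear (cinner z)"
proof (rule bounded_linear_intro[where K = "norm z"])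
  show "cinner z (r *\<^sub>R x) = r *\<^sub>R cinner z x" for r x
    by (simp add: scaleR_scaleC cinner_scaleC_right scaleR_conv_of_real)
  show "cmod (cinner z x) \<le> norm x * norm z" for x
    using cinner_Cauchy_Schwarz[of z x] by (simp add: mult.commute)
qed (rule cinner_add_right)

lemmas tendsto_cinner_right = bounded_linear.tendsto[OF bounded_linear_cinner_right]

lemma tendsto_cinner_left:
  assumes "(f \<longlongrightarrow> l) F"
  shows "((\<lambda>n. cinner (f n) z) \<longlongrightarrow> cinner l z) F"
  unfolding cinner_commute[of _ z]
  by (intro tendsto_cnj tendsto_cinner_right assms)

lemma parallelogram_law:
  fixes x y :: "'a::complex_inner"
  shows "(norm (x + y))\<^sup>2 + (norm (x - y))\<^sup>2 = 2 * (norm x)\<^sup>2 + 2 * (norm y)\<^sup>2"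
  by (simp add: norm_square_eq_Re_cinner cinner_add_left cinner_add_right cinner_diff_left
      cinner_diff_right)

section \<open>Adjoints of isometries\<close>

text \<open>
  A map that has an adjoint in this sense is automatically linear (\<open>adjoint_pair_linear\<close>).
\<close>

definition adjoint_pair :: "('a::complex_inner \<Rightarrow> 'b::complex_inner) \<Rightarrow> ('b \<Rightarrow> 'a) \<Rightarrow> bool" where
  "adjoint_pair A B \<longleftrightarrow> (\<forall>x y. cinner (A x) y = cinner x (B y))"

lemma adjoint_pairD: "adjoint_pair A B \<Longrightarrow> cinner (A x) y = cinner x (B y)"
  by (simp add: adjoint_pair_def)

lemma adjoint_pair_sym: "adjoint_pair A B \<Longrightarrow> adjoint_pair B A"
  unfolding adjoint_pair_def by (metis cinner_commute)

lemma adjoint_pair_comp: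
  "adjoint_pair A B \<Longrightarrow> adjoint_pair C D \<Longrightarrow> adjoint_pair (\<lambda>x. A (C x)) (\<lambda>y. D (B y))"
  by (simp add: adjoint_pair_def)

lemma adjoint_pair_diff:
  "adjoint_pair A B \<Longrightarrow> adjoint_pair C D \<Longrightarrow> adjoint_pair (\<lambda>x. A x - C x) (\<lambda>y. B y - D y)"
  by (simp add: adjoint_pair_def cinner_diff_left cinner_diff_right)

lemma adjoint_pair_ident: "adjoint_pair (\<lambda>x. x) (\<lambda>x. x)"
  by (simp add: adjoint_pair_def)

lemma adjoint_pair_linear:
  assumes "adjoint_pair A B"
  shows adjoint_pair_map_add: "A (x + y) = A x + A y"
    and adjoint_pair_map_diff: "A (x - y) = A x - A y"
    and adjoint_pair_map_zero: "A 0 = 0"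
    and adjoint_pair_map_scaleC: "A (c *\<^sub>C x) = c *\<^sub>C A x"
proof -
  note [simp] = adjoint_pairD[OF adjoint_pair_sym[OF assms], symmetric]
  show "A (x + y) = A x + A y"
    by (rule cinner_ext) (simp add: cinner_add_right)
  show "A (x - y) = A x - A y"
    by (rule cinner_ext) (simp add: cinner_diff_right)
  show "A 0 = 0"
    by (rule cinner_ext) simp
  show "A (c *\<^sub>C x) = c *\<^sub>C A x"
    by (rule cinner_ext) (simp add: cinner_scaleC_right)
qed

text \<open>
  The vector \<open>p\<close> is the point of \<open>S\<close> nearest to \<open>x\<close>. By the parallelogram law every minimising
  sequence is Cauchy, and at the minimum no component of \<open>x - p\<close> along a vector of \<open>S\<close> can be
  subtracted with a gain.
\<close>

lemma orthogonal_projection_exists: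
  fixes S :: "'a::complex_inner set"
  assumes "complete S" and sub: "complex_vector.subspace S"
  shows "\<exists>p\<in>S. \<forall>s\<in>S. cinner s (x - p) = 0"
proof -
  define d where "d = (INF s\<in>S. (norm (x - s))\<^sup>2)"
  have "S \<noteq> {}"
    using complex_vector.subspace_0[OF sub] by auto
  have bdd: "bdd_below ((\<lambda>s. (norm (x - s))\<^sup>2) ` S)"
    by (rule bdd_belowI2[where m = 0]) simp
  have d_le: "d \<le> (norm (x - s))\<^sup>2" if "s \<in> S" for s
    unfolding d_def by (rule cINF_lower[OF bdd that])
  have "\<exists>s\<in>S. (norm (x - s))\<^sup>2 < d + inverse (real (Suc n))" for n
    using cINF_less_iff[OF \<open>S \<noteq> {}\<close> bdd, of "d + inverse (real (Suc n))"]
    by (simp add: d_def[symmetric])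
  then obtain s where s: "\<And>n. s n \<in> S"
    and s_less: "\<And>n. (norm (x - s n))\<^sup>2 < d + inverse (real (Suc n))"
    by metis
  have half: "(1/2) *\<^sub>R (a + b) \<in> S" if "a \<in> S" "b \<in> S" for a b
    unfolding scaleR_scaleC
    by (intro complex_vector.subspace_scale[OF sub] complex_vector.subspace_add[OF sub] that)
  have dist_s: "(norm (s m - s n))\<^sup>2 \<le> 2 * inverse (real (Suc m)) + 2 * inverse (real (Suc n))"
    for m n
  proof -
    have "(norm ((x - s n) + (x - s m)))\<^sup>2 + (norm ((x - s n) - (x - s m)))\<^sup>2
        = 2 * (norm (x - s n))\<^sup>2 + 2 * (norm (x - s m))\<^sup>2"
      by (rule parallelogram_law)
    moreover have "(x - s n) - (x - s m) = s m - s n"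
      by simp
    moreover have "(x - s n) + (x - s m) = 2 *\<^sub>R (x - (1/2) *\<^sub>R (s m + s n))"
      by (simp add: scaleR_diff_right scaleR_2)
    moreover have "(norm (2 *\<^sub>R (x - (1/2) *\<^sub>R (s m + s n))))\<^sup>2 \<ge> 4 * d"
      using d_le[OF half[OF s s, of m n]] by (simp add: power_mult_distrib)
    ultimately show ?thesis
      using s_less[of m] s_less[of n] by simp
  qed
  have "Cauchy s"
  proof (rule CauchyI)
    fix e :: real assume "0 < e"
    then obtain N where N: "inverse (real (Suc N)) < e\<^sup>2 / 4"
      using reals_Archimedean[of "e\<^sup>2 / 4"] by auto
    have "norm (s m - s n) < e" if "m \<ge> N" "n \<ge> N" for m n
    proof -
      have "inverse (real (Suc m)) \<le> inverse (real (Suc N))"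
        "inverse (real (Suc n)) \<le> inverse (real (Suc N))"
        using that by (auto intro!: le_imp_inverse_le)
      then have "(norm (s m - s n))\<^sup>2 < e\<^sup>2"
        using dist_s[of m n] N by linarith
      then show ?thesis
        by (rule power2_less_imp_less) (use \<open>0 < e\<close> in simp)
    qed
    then show "\<exists>M. \<forall>m\<ge>M. \<forall>n\<ge>M. norm (s m - s n) < e"
      by blast
  qed
  then obtain p where p: "p \<in> S" "s \<longlonglongrightarrow> p"
    using \<open>complete S\<close> s unfolding complete_def by blast
  have "(norm (x - p))\<^sup>2 \<le> d"
  proof (rule LIMSEQ_le)
    show "(\<lambda>n. (norm (x - s n))\<^sup>2) \<longlonglongrightarrow> (norm (x - p))\<^sup>2"
      by (intro tendsto_intros p)
    show "(\<lambda>n. d + inverse (real (Suc n))) \<longlonglongrightarrow> d"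
      using tendsto_add[OF tendsto_const LIMSEQ_inverse_real_of_nat, of d] by simp
    show "\<exists>N. \<forall>n\<ge>N. (norm (x - s n))\<^sup>2 \<le> d + inverse (real (Suc n))"
      using s_less less_imp_le by blast
  qed
  have "cinner t (x - p) = 0" if "t \<in> S" for t
  proof -
    define c where "c = cinner t (x - p) / of_real ((norm t)\<^sup>2)"
    have "p + c *\<^sub>C t \<in> S"
      by (intro complex_vector.subspace_scale[OF sub] complex_vector.subspace_add[OF sub] that p)
    then have "d \<le> (norm (x - p - c *\<^sub>C t))\<^sup>2"
      using d_le by (simp add: diff_diff_add)
    then have "(cmod (cinner t (x - p)))\<^sup>2 / (norm t)\<^sup>2 \<le> 0"
      using \<open>(norm (x - p))\<^sup>2 \<le> d\<close> unfolding c_def norm_minus_component by simp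
    then show ?thesis
      by (cases "t = 0") (auto simp: divide_le_0_iff)
  qed
  with p show ?thesis
    by blast
qed

lemma linear_isometryD:
  assumes "linear_isometry U"
  shows "U (x + y) = U x + U y" "U (c *\<^sub>C x) = c *\<^sub>C U x" "norm (U x) = norm x"
  using assms unfolding linear_isometry_def Vector_Spaces.linear_iff by auto

text \<open>
  Polarization: the real part of the inner product is a combination of squared norms, and the
  imaginary part is the real part after scaling one argument by the imaginary unit.
\<close>

lemma linear_isometry_cinner:
  assumes "linear_isometry U"
  shows "cinner (U x) (U y) = cinner x y"
proof -
  have Re_cinner: "2 * Re (cinner u v) = (norm (u + v))\<^sup>2 - (norm u)\<^sup>2 - (norm v)\<^sup>2"
    for u v :: "'c::complex_inner"
    using cinner_commute[of v u]
    by (simp add: norm_square_eq_Re_cinner cinner_add_left cinner_add_right)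
  have Re_eq: "Re (cinner (U u) (U v)) = Re (cinner u v)" for u v
    using Re_cinner[of "U u" "U v"] Re_cinner[of u v]
    by (simp add: linear_isometryD[OF assms] flip: linear_isometryD(1)[OF assms])
  have "Im (cinner (U x) (U y)) = Im (cinner x y)"
    using Re_eq[of x "\<i> *\<^sub>C y"] by (simp add: linear_isometryD[OF assms] cinner_scaleC_right)
  with Re_eq show ?thesis
    by (simp add: complex_eq_iff)
qed

text \<open>
  The adjoint sends \<open>y\<close> to the preimage under \<open>U\<close> of the projection of \<open>y\<close> to the range, which is
  complete as an isometric image of a complete space.
\<close>

lemma linear_isometry_adjoint_exists:
  fixes U :: "'a::chilbert_space \<Rightarrow> 'b::complex_inner"
  assumes U: "linear_isometry U"
  obtains U' where "adjoint_pair U U'" "\<And>x. U' (U x) = x"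
proof -
  have lin: "Vector_Spaces.linear (*\<^sub>C) (*\<^sub>C) U"
    using U by (simp add: linear_isometry_def)
  interpret U: Vector_Spaces.linear "(*\<^sub>C)" "(*\<^sub>C)" U
    by (rule lin)
  have norm_diff: "norm (U x - U y) = norm (x - y)" for x y
    using linear_isometryD(3)[OF U, of "x - y"] by (simp only: U.diff)
  have "complete (range U)"
    unfolding complete_def
  proof (intro allI impI)
    fix f assume f: "(\<forall>n. f n \<in> range U) \<and> Cauchy f"
    then have "\<forall>n. \<exists>x. f n = U x"
      by blast
    then obtain g where g: "\<And>n. f n = U (g n)"
      by metis
    have "Cauchy g"
      using f unfolding Cauchy_def dist_norm g norm_diff by blast
    then obtain l where "g \<longlonglongrightarrow> l"
      using Cauchy_convergent convergent_def by blast
    then have "f \<longlonglongrightarrow> U l"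
      unfolding LIMSEQ_iff g norm_diff .
    then show "\<exists>l\<in>range U. f \<longlonglongrightarrow> l"
      by blast
  qed
  moreover have "complex_vector.subspace (range U)"
    by (rule U.subspace_image) (rule complex_vector.subspace_UNIV)
  ultimately have "\<exists>z. \<forall>x. cinner (U x) (y - U z) = 0" for y
    using orthogonal_projection_exists[of "range U" y] by auto
  then obtain U' where U': "\<And>x y. cinner (U x) (y - U (U' y)) = 0"
    by metis
  have adj: "cinner (U x) y = cinner x (U' y)" for x y
    using U'[of x y] by (simp add: cinner_diff_right linear_isometry_cinner[OF U])
  show ?thesis
  proof
    show "adjoint_pair U U'"
      using adj by (simp add: adjoint_pair_def)
    show "U' (U x) = x" for x
      by (rule cinner_ext) (simp add: linear_isometry_cinner[OF U] flip: adj)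
  qed
qed

text \<open>
  Linearity comes from the existence of the adjoint, and \<open>U\<close> preserves norms because the inner
  product of \<open>U x\<close> with itself equals that of \<open>x\<close> with \<open>W (U x)\<close>.
\<close>

lemma unitary_transformationI:
  assumes adj: "adjoint_pair U W" and "\<And>x. W (U x) = x" and "\<And>y. U (W y) = y"
  shows "unitary_transformation U"
proof -
  have "(norm (U x))\<^sup>2 = (norm x)\<^sup>2" for x
    by (simp add: norm_square_eq_Re_cinner adjoint_pairD[OF adj] assms(2))
  then have "norm (U x) = norm x" for x
    by simp
  moreover have "Vector_Spaces.linear (*\<^sub>C) (*\<^sub>C) U"
    unfolding Vector_Spaces.linear_iff
    by (auto simp: adjoint_pair_linear[OF adj] intro: complex_vector.vector_space_axioms)
  moreover have "surj U"
    using assms(3) by (metis surjI)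
  ultimately show ?thesis
    by (simp add: unitary_transformation_def linear_isometry_def)
qed

section \<open>Intertwining self-adjoint operators\<close>

text \<open>
  All uses of self-adjointness below go through this test for membership in the graph of \<open>T\<close>.
  Its two directions are symmetry and maximality of \<open>T\<close>. Density of the
  domain makes the vector \<open>z\<close> unique.
\<close>

lemma self_adjoint_operator_graph_iff:
  assumes "self_adjoint_operator T"
  shows "T y = Some z \<longleftrightarrow> (\<forall>x w. T x = Some w \<longrightarrow> cinner y w = cinner z x)"
proof -
  have dense: "closure (dom T) = UNIV" and T: "T = adjoint_operator T"
    using assms by (auto simp: self_adjoint_operator_def)
  define A where "A z \<longleftrightarrow> (\<forall>x\<in>dom T. cinner y (the (T x)) = cinner z x)" for z
  have unique: "z = z'" if "A z" "A z'" for z z'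
  proof (rule ccontr)
    have "closed {x. cinner (z - z') x = 0}"
      by (intro closed_Collect_eq continuous_intros
          bounded_linear.continuous_on[OF bounded_linear_cinner_right])
    moreover have "dom T \<subseteq> {x. cinner (z - z') x = 0}"
      using that by (auto simp: A_def cinner_diff_left)
    ultimately have "closure (dom T) \<subseteq> {x. cinner (z - z') x = 0}"
      by (intro closure_minimal)
    then have "cinner (z - z') (z - z') = 0"
      using dense by auto
    moreover assume "z \<noteq> z'"
    ultimately show False
      by (simp add: cinner_self)
  qed
  have "T y = (if \<exists>z. A z then Some (THE z. A z) else None)"
    by (subst T) (simp add: adjoint_operator_def A_def[abs_def])
  then have "T y = Some z \<longleftrightarrow> A z"
    using unique by (auto intro: the_equality theI)
  also have "A z \<longleftrightarrow> (\<forall>x w. T x = Some w \<longrightarrow> cinner y w = cinner z x)"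
    unfolding A_def by force
  finally show ?thesis .
qed

lemma self_adjoint_operator_graphI:
  assumes "self_adjoint_operator T" "\<And>x w. T x = Some w \<Longrightarrow> cinner y w = cinner z x"
  shows "T y = Some z"
  using assms(2) by (subst self_adjoint_operator_graph_iff[OF assms(1)]) blast

lemma self_adjoint_operator_symmetric:
  assumes "self_adjoint_operator T" "T y = Some z" "T x = Some w"
  shows "cinner y w = cinner z x"
  using assms(2) assms(3) by (subst (asm) self_adjoint_operator_graph_iff[OF assms(1)]) blast

definition intertwines ::
    "('a \<Rightarrow> 'b) \<Rightarrow> ('a \<rightharpoonup> 'a) \<Rightarrow> ('b \<rightharpoonup> 'b) \<Rightarrow> bool" where
  "intertwines A S T \<longleftrightarrow> (\<forall>x y. S x = Some y \<longrightarrow> T (A x) = Some (A y))"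

lemma intertwines_iff_map_le:
  "intertwines A S T \<longleftrightarrow> (Some \<circ> A) \<circ>\<^sub>m S \<subseteq>\<^sub>m T \<circ>\<^sub>m (Some \<circ> A)"
  unfolding intertwines_def map_le_def map_comp_def dom_def
  by (auto split: option.splits)

lemma intertwines_comp:
  "intertwines A S T \<Longrightarrow> intertwines B R S \<Longrightarrow> intertwines (\<lambda>x. A (B x)) R T"
  by (simp add: intertwines_def)

lemma intertwines_ident: "intertwines (\<lambda>x. x) T T"
  by (simp add: intertwines_def)

lemma intertwines_add:
  assumes T: "self_adjoint_operator T" and "intertwines A S T" "intertwines B S T"
  shows "intertwines (\<lambda>x. A x + B x) S T"
  unfolding intertwines_def
proof (intro allI impI)
  fix x y assume "S x = Some y"
  then have "T (A x) = Some (A y)" "T (B x) = Some (B y)"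
    using assms(2,3) by (auto simp: intertwines_def)
  then show "T (A x + B x) = Some (A y + B y)"
    by (intro self_adjoint_operator_graphI[OF T])
      (simp add: cinner_add_left self_adjoint_operator_symmetric[OF T])
qed

lemma intertwines_diff:
  assumes T: "self_adjoint_operator T" and "intertwines A S T" "intertwines B S T"
  shows "intertwines (\<lambda>x. A x - B x) S T"
  unfolding intertwines_def
proof (intro allI impI)
  fix x y assume "S x = Some y"
  then have "T (A x) = Some (A y)" "T (B x) = Some (B y)"
    using assms(2,3) by (auto simp: intertwines_def)
  then show "T (A x - B x) = Some (A y - B y)"
    by (intro self_adjoint_operator_graphI[OF T])
      (simp add: cinner_diff_left self_adjoint_operator_symmetric[OF T])
qed

lemma intertwines_zero:
  assumes "self_adjoint_operator T"
  shows "intertwines (\<lambda>x. 0) S T"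
  by (auto simp: intertwines_def intro: self_adjoint_operator_graphI[OF assms])

text \<open>
  If \<open>T y = z\<close>, then pairing \<open>B y\<close> with \<open>S x\<close> amounts to pairing \<open>y\<close> with \<open>A (S x) = T (A x)\<close>, hence
  \<open>z\<close> with \<open>A x\<close>, hence \<open>B z\<close> with \<open>x\<close>. This is the test for \<open>S (B y) = B z\<close>.
\<close>

lemma intertwines_adjoint:
  assumes S: "self_adjoint_operator S" and T: "self_adjoint_operator T"
    and adj: "adjoint_pair A B" and A: "intertwines A S T"
  shows "intertwines B T S"
  unfolding intertwines_def
proof (intro allI impI)
  fix y z assume yz: "T y = Some z"
  show "S (B y) = Some (B z)"
  proof (rule self_adjoint_operator_graphI[OF S])
    fix x w assume "S x = Some w"
    then have "T (A x) = Some (A w)"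
      using A by (simp add: intertwines_def)
    then have "cinner y (A w) = cinner z (A x)"
      by (rule self_adjoint_operator_symmetric[OF T yz])
    then show "cinner (B y) w = cinner (B z) x"
      by (simp add: adjoint_pairD[OF adjoint_pair_sym[OF adj]])
  qed
qed

text \<open>The graph of \<open>T\<close> is closed, being cut out by continuous equations.\<close>

lemma intertwines_limit:
  assumes T: "self_adjoint_operator T"
    and A: "\<And>n. intertwines (A n) S T" and lim: "\<And>x. (\<lambda>n. A n x) \<longlonglongrightarrow> B x"
  shows "intertwines B S T"
  unfolding intertwines_def
proof (intro allI impI)
  fix x y assume xy: "S x = Some y"
  show "T (B x) = Some (B y)"
  proof (rule self_adjoint_operator_graphI[OF T])
    fix u w assume uw: "T u = Some w"
    have "cinner (A n x) w = cinner (A n y) u" for n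
      using A xy uw self_adjoint_operator_symmetric[OF T] unfolding intertwines_def by blast
    then have "(\<lambda>n. cinner (A n y) u) \<longlonglongrightarrow> cinner (B x) w"
      using tendsto_cinner_left[OF lim, of x w] by simp
    then show "cinner (B x) w = cinner (B y) u"
      using tendsto_cinner_left[OF lim] LIMSEQ_unique by blast
  qed
qed

section \<open>The projection generated by a wandering subspace\<close>

text \<open>
  Here \<open>V\<close> is an isometry with adjoint \<open>V'\<close>, and \<open>E\<close> is a projection whose range is orthogonal
  to that of \<open>V\<close>.
\<close>

locale wandering_projection =
  fixes V V' E :: "'a::chilbert_space \<Rightarrow> 'a"
  assumes V_adjoint: "adjoint_pair V V'"
    and V'_V: "V' (V x) = x"
    and E_self_adjoint: "adjoint_pair E E"
    and E_E: "E (E x) = E x"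
    and V'_E: "V' (E x) = 0"
begin

text \<open>The sum of \<open>V\<^sup>k E V'\<^sup>k\<close> over \<open>k < n\<close>, in Horner form.\<close>

primrec partial_projection :: "nat \<Rightarrow> 'a \<Rightarrow> 'a" where
  "partial_projection 0 x = 0"
| "partial_projection (Suc n) x = E x + V (partial_projection n (V' x))"

lemma E_V: "E (V x) = 0"
proof (rule cinner_ext)
  fix z
  have "cinner z (E (V x)) = cinner (V' (E z)) x"
    by (simp add: adjoint_pairD[OF adjoint_pair_sym[OF V_adjoint]] adjoint_pairD[OF E_self_adjoint])
  then show "cinner z (E (V x)) = cinner z 0"
    by (simp add: V'_E)
qed

lemma partial_projection_self_adjoint:
  "adjoint_pair (partial_projection n) (partial_projection n)"
proof (induction n)
  case 0
  show ?case by (simp add: adjoint_pair_def)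
next
  case (Suc n)
  then show ?case
    by (auto simp: adjoint_pair_def cinner_add_left cinner_add_right
        adjoint_pairD[OF V_adjoint] adjoint_pairD[OF E_self_adjoint]
        adjoint_pairD[OF adjoint_pair_sym[OF V_adjoint]])
qed

lemmas partial_projection_linear = adjoint_pair_linear[OF partial_projection_self_adjoint]
lemmas V_linear = adjoint_pair_linear[OF V_adjoint]
lemmas V'_linear = adjoint_pair_linear[OF adjoint_pair_sym[OF V_adjoint]]
lemmas E_linear = adjoint_pair_linear[OF E_self_adjoint]

text \<open>
  The partial sums are nested projections: in the product all mixed terms vanish, because
  \<open>E V = 0 = V' E\<close>.
\<close>

lemma partial_projection_comp:
  "partial_projection m (partial_projection n x) = partial_projection (min m n) x"
proof (induction m arbitrary: n x)
  case 0
  show ?case by simp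
next
  case (Suc m)
  show ?case
    by (cases n) (simp_all add: Suc partial_projection_linear E_linear V'_linear V_linear
        E_E E_V V'_E V'_V)
qed

text \<open>
  The squared norms of the partial sums increase with the index, are bounded by the squared norm of
  \<open>x\<close>, and their differences are the squared norms of the differences of the partial sums.
\<close>

lemma partial_projection_convergent: "convergent (\<lambda>n. partial_projection n x)"
proof -
  let ?S = "\<lambda>n. partial_projection n x"
  have cinner_S: "cinner (?S m) (?S n) = cinner x (partial_projection (min m n) x)" for m n
    by (simp add: adjoint_pairD[OF partial_projection_self_adjoint] partial_projection_comp)
  have diff: "(norm (?S n - ?S m))\<^sup>2 = (norm (?S n))\<^sup>2 - (norm (?S m))\<^sup>2" if "m \<le> n" for m n
    using that
    by (simp add: norm_square_eq_Re_cinner cinner_diff_left cinner_diff_right cinner_S min_def)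
  have mono: "incseq (\<lambda>n. (norm (?S n))\<^sup>2)"
  proof (rule incseq_SucI)
    show "(norm (?S n))\<^sup>2 \<le> (norm (?S (Suc n)))\<^sup>2" for n
      using diff[of n "Suc n"] zero_le_power2[of "norm (?S (Suc n) - ?S n)"] by linarith
  qed
  have "(norm (?S n))\<^sup>2 \<le> (norm x)\<^sup>2" for n
  proof -
    have "(norm (?S n))\<^sup>2 = Re (cinner x (?S n))"
      by (simp add: norm_square_eq_Re_cinner cinner_S)
    also have "\<dots> \<le> norm x * norm (?S n)"
      using complex_Re_le_cmod cinner_Cauchy_Schwarz order_trans by blast
    finally have "norm (?S n) \<le> norm x"
      by (cases "?S n = 0") (simp_all add: power2_eq_square)
    then show ?thesis
      by (simp add: power_mono)
  qed
  then obtain L where "(\<lambda>n. (norm (?S n))\<^sup>2) \<longlonglongrightarrow> L"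
    using incseq_convergent[OF mono] by metis
  then have Cauchy_norm: "Cauchy (\<lambda>n. (norm (?S n))\<^sup>2)"
    by (rule LIMSEQ_imp_Cauchy)
  have "Cauchy ?S"
    unfolding Cauchy_altdef2
  proof (intro allI impI)
    fix e :: real assume "0 < e"
    then obtain N where N: "\<And>n. n \<ge> N \<Longrightarrow> dist ((norm (?S n))\<^sup>2) ((norm (?S N))\<^sup>2) < e\<^sup>2"
      using Cauchy_norm unfolding Cauchy_altdef2 by (meson zero_less_power)
    have "dist (?S n) (?S N) < e" if "n \<ge> N" for n
    proof -
      have "(norm (?S n - ?S N))\<^sup>2 < e\<^sup>2"
        using N[OF that] unfolding diff[OF that] dist_real_def by linarith
      then show ?thesis
        unfolding dist_norm by (rule power2_less_imp_less) (use \<open>0 < e\<close> in simp)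
    qed
    then show "\<exists>N. \<forall>n\<ge>N. dist (?S n) (?S N) < e"
      by blast
  qed
  then show ?thesis
    by (rule Cauchy_convergent)
qed

definition P :: "'a \<Rightarrow> 'a" where
  "P x = lim (\<lambda>n. partial_projection n x)"

lemma partial_projection_tendsto: "(\<lambda>n. partial_projection n x) \<longlonglongrightarrow> P x"
  unfolding P_def using partial_projection_convergent by (simp add: convergent_LIMSEQ_iff)

lemma P_self_adjoint: "adjoint_pair P P"
  unfolding adjoint_pair_def
proof (intro allI)
  fix x y
  have "(\<lambda>n. cinner (partial_projection n x) y) \<longlonglongrightarrow> cinner x (P y)"
    unfolding adjoint_pairD[OF partial_projection_self_adjoint]
    by (rule tendsto_cinner_right[OF partial_projection_tendsto])
  with tendsto_cinner_left[OF partial_projection_tendsto] show "cinner (P x) y = cinner x (P y)"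
    by (rule LIMSEQ_unique)
qed

text \<open>
  The limit of the recursion for the partial sums. It is taken weakly, with \<open>V\<close> moved to
  \<open>V'\<close> in the other argument of the inner product. The commutation rules and \<open>E P = E\<close> are read off from this equation.
\<close>

lemma P_eq: "P x = E x + V (P (V' x))"
proof (rule cinner_ext)
  fix z
  have "(\<lambda>n. cinner z (partial_projection (Suc n) x)) \<longlonglongrightarrow> cinner z (P x)"
    by (rule tendsto_cinner_right[OF LIMSEQ_Suc[OF partial_projection_tendsto]])
  moreover have "(\<lambda>n. cinner z (E x) + cinner (V' z) (partial_projection n (V' x)))
      \<longlonglongrightarrow> cinner z (E x) + cinner (V' z) (P (V' x))"
    by (rule tendsto_add[OF tendsto_const tendsto_cinner_right[OF partial_projection_tendsto]])
  ultimately have "cinner z (P x) = cinner z (E x) + cinner (V' z) (P (V' x))"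
    unfolding partial_projection.simps cinner_add_right
      adjoint_pairD[OF adjoint_pair_sym[OF V_adjoint]]
    by (rule LIMSEQ_unique)
  then show "cinner z (P x) = cinner z (E x + V (P (V' x)))"
    by (simp add: cinner_add_right adjoint_pairD[OF adjoint_pair_sym[OF V_adjoint]])
qed

lemmas P_linear = adjoint_pair_linear[OF P_self_adjoint]

lemma P_V: "P (V x) = V (P x)"
  using P_eq[of "V x"] by (simp add: E_V V'_V)

lemma P_V': "P (V' x) = V' (P x)"
  using P_eq[of x] by (simp add: V'_linear V'_E V'_V)

lemma E_P: "E (P x) = E x"
  using P_eq[of x] by (simp add: E_linear E_E E_V)

lemma P_P: "P (P x) = P x"
proof -
  have "partial_projection n (P x) = partial_projection n x" for n
    by (induction n arbitrary: x) (simp_all add: E_P flip: P_V')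
  then have "(\<lambda>n. partial_projection n x) \<longlonglongrightarrow> P (P x)"
    using partial_projection_tendsto[of "P x"] by simp
  then show ?thesis
    using partial_projection_tendsto by (rule LIMSEQ_unique)
qed

lemma intertwines_P:
  assumes T: "self_adjoint_operator T"
    and "intertwines V T T" "intertwines E T T"
  shows "intertwines P T T"
proof (rule intertwines_limit[OF T _ partial_projection_tendsto])
  have V': "intertwines V' T T"
    by (rule intertwines_adjoint[OF T T V_adjoint assms(2)])
  show "intertwines (partial_projection n) T T" for n
  proof (induction n)
    case 0
    show ?case
      using intertwines_zero[OF T] by (simp add: intertwines_def)
  next
    case (Suc n)
    have "intertwines (\<lambda>x. E x + V (partial_projection n (V' x))) T T"
      by (intro intertwines_add[OF T] assms intertwines_comp[OF assms(2)]
          intertwines_comp[OF Suc.IH] V')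
    then show ?case
      by (simp add: intertwines_def)
  qed
qed

end

section \<open>Cantor--Bernstein for self-adjoint operators\<close>

theorem theorem3p1:
  fixes T\<^sub>1 :: "'a::chilbert_space \<rightharpoonup> 'a"
    and T\<^sub>2 :: "'b::chilbert_space \<rightharpoonup> 'b"
    and U\<^sub>1 :: "'a \<Rightarrow> 'b"
    and U\<^sub>2 :: "'b \<Rightarrow> 'a"
  assumes "self_adjoint_operator T\<^sub>1"
    and "self_adjoint_operator T\<^sub>2"
    and "linear_isometry U\<^sub>1"
    and "linear_isometry U\<^sub>2"
    and "(Some \<circ> U\<^sub>1) \<circ>\<^sub>m T\<^sub>1 \<subseteq>\<^sub>m T\<^sub>2 \<circ>\<^sub>m (Some \<circ> U\<^sub>1)"
    and "(Some \<circ> U\<^sub>2) \<circ>\<^sub>m T\<^sub>2 \<subseteq>\<^sub>m T\<^sub>1 \<circ>\<^sub>m (Some \<circ> U\<^sub>2)"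
  shows "\<exists>U :: 'a \<Rightarrow> 'b. unitary_transformation U \<and>
           (Some \<circ> U) \<circ>\<^sub>m T\<^sub>1 \<circ>\<^sub>m (Some \<circ> inv U) = T\<^sub>2"
proof -
  note T\<^sub>1 = assms(1) and T\<^sub>2 = assms(2)
  obtain U\<^sub>1' where U\<^sub>1': "adjoint_pair U\<^sub>1 U\<^sub>1'" and U\<^sub>1'_U\<^sub>1: "\<And>x. U\<^sub>1' (U\<^sub>1 x) = x"
    using linear_isometry_adjoint_exists[OF assms(3)] by blast
  obtain U\<^sub>2' where U\<^sub>2': "adjoint_pair U\<^sub>2 U\<^sub>2'" and U\<^sub>2'_U\<^sub>2: "\<And>x. U\<^sub>2' (U\<^sub>2 x) = x"
    using linear_isometry_adjoint_exists[OF assms(4)] by blast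
  note adj = U\<^sub>1' U\<^sub>2' adjoint_pair_sym[OF U\<^sub>1'] adjoint_pair_sym[OF U\<^sub>2']
  note lin = adj[THEN adjoint_pair_map_add] adj[THEN adjoint_pair_map_diff]
    adj[THEN adjoint_pair_map_zero]
  have int_U\<^sub>1: "intertwines U\<^sub>1 T\<^sub>1 T\<^sub>2" and int_U\<^sub>2: "intertwines U\<^sub>2 T\<^sub>2 T\<^sub>1"
    using assms(5,6) by (simp_all add: intertwines_iff_map_le)
  have int_U\<^sub>2': "intertwines U\<^sub>2' T\<^sub>1 T\<^sub>2"
    by (rule intertwines_adjoint[OF T\<^sub>2 T\<^sub>1 U\<^sub>2' int_U\<^sub>2])

  define E where "E x = x - U\<^sub>2 (U\<^sub>2' x)" for x
  interpret wandering_projection "\<lambda>x. U\<^sub>2 (U\<^sub>1 x)" "\<lambda>x. U\<^sub>1' (U\<^sub>2' x)" E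
  proof
    show "adjoint_pair (\<lambda>x. U\<^sub>2 (U\<^sub>1 x)) (\<lambda>x. U\<^sub>1' (U\<^sub>2' x))"
      by (rule adjoint_pair_comp[OF U\<^sub>2' U\<^sub>1'])
    show "adjoint_pair E E"
      unfolding E_def
      by (intro adjoint_pair_diff adjoint_pair_ident adjoint_pair_comp[OF U\<^sub>2'] adj)
  qed (simp_all add: E_def lin U\<^sub>1'_U\<^sub>1 U\<^sub>2'_U\<^sub>2)
  have int_P: "intertwines P T\<^sub>1 T\<^sub>1"
  proof (rule intertwines_P[OF T\<^sub>1])
    show "intertwines (\<lambda>x. U\<^sub>2 (U\<^sub>1 x)) T\<^sub>1 T\<^sub>1"
      by (rule intertwines_comp[OF int_U\<^sub>2 int_U\<^sub>1])
    show "intertwines E T\<^sub>1 T\<^sub>1"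
      unfolding E_def
      by (intro intertwines_diff[OF T\<^sub>1] intertwines_ident intertwines_comp[OF int_U\<^sub>2 int_U\<^sub>2'])
  qed

  define U where "U x = U\<^sub>1 (P x) + U\<^sub>2' (x - P x)" for x
  define W where "W y = P (U\<^sub>1' y) + (U\<^sub>2 y - P (U\<^sub>2 y))" for y
  have U_W_adjoint: "adjoint_pair U W"
    by (simp add: adjoint_pair_def U_def W_def cinner_add_left cinner_add_right cinner_diff_left
        cinner_diff_right adj[THEN adjoint_pairD] adjoint_pairD[OF P_self_adjoint])
  have W_U: "W (U x) = x" for x
  proof -
    define r where "r = x - P x"
    \<comment> \<open>The vector \<open>r\<close> is annihilated by \<open>E\<close>, so it lies in the range of \<open>U\<^sub>2\<close>.\<close>
    have P_r: "P r = 0"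
      by (simp add: r_def P_linear P_P)
    have "E r = 0"
      by (simp add: r_def E_linear E_P)
    then have r: "U\<^sub>2 (U\<^sub>2' r) = r"
      by (simp add: E_def)
    have "P (U\<^sub>1' (U x)) = P x"
      using P_V'[of r] by (simp add: U_def lin P_linear U\<^sub>1'_U\<^sub>1 P_P P_r flip: r_def)
    moreover have "U\<^sub>2 (U x) = U\<^sub>2 (U\<^sub>1 (P x)) + r"
      by (simp add: U_def lin(2) r flip: r_def)
    moreover have "P (U\<^sub>2 (U\<^sub>1 (P x)) + r) = U\<^sub>2 (U\<^sub>1 (P x))"
      by (simp add: P_linear P_V P_P P_r)
    ultimately show ?thesis
      by (simp add: W_def r_def)
  qed
  have U_W: "U (W y) = y" for y
  proof -
    have "P (W y) = P (U\<^sub>1' y)"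
      by (simp add: W_def P_linear P_P)
    then have "U (W y) = U\<^sub>1 (P (U\<^sub>1' y)) + (y - U\<^sub>2' (P (U\<^sub>2 y)))"
      by (simp add: U_def W_def lin U\<^sub>2'_U\<^sub>2)
    moreover have "P (U\<^sub>2 y) = U\<^sub>2 (U\<^sub>1 (P (U\<^sub>1' y)))"
      using P_eq[of "U\<^sub>2 y"] by (simp add: E_def U\<^sub>2'_U\<^sub>2)
    ultimately show ?thesis
      by (simp add: U\<^sub>2'_U\<^sub>2)
  qed

  have int_U: "intertwines U T\<^sub>1 T\<^sub>2"
    unfolding U_def
    by (intro intertwines_add[OF T\<^sub>2] intertwines_comp[OF int_U\<^sub>1 int_P] intertwines_comp[OF int_U\<^sub>2']
        intertwines_diff[OF T\<^sub>1] intertwines_ident int_P)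
  have int_W: "intertwines W T\<^sub>2 T\<^sub>1"
    by (rule intertwines_adjoint[OF T\<^sub>1 T\<^sub>2 U_W_adjoint int_U])
  have inv_U: "inv U = W"
    by (rule inv_equality) (simp_all add: W_U U_W)
  have "((Some \<circ> U) \<circ>\<^sub>m T\<^sub>1 \<circ>\<^sub>m (Some \<circ> inv U)) y = T\<^sub>2 y" for y
  proof (cases "T\<^sub>1 (W y)")
    case None
    \<comment> \<open>A value of \<open>T\<^sub>2\<close> at \<open>y\<close> would be carried by \<open>W\<close> to a value of \<open>T\<^sub>1\<close> at \<open>W y\<close>.\<close>
    then have "T\<^sub>2 y = None"
      using int_W unfolding intertwines_def by (metis not_Some_eq)
    with None show ?thesis
      by (simp add: map_comp_def inv_U)
  next
    case (Some v)
    then have "T\<^sub>2 (U (W y)) = Some (U v)"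
      using int_U by (simp add: intertwines_def)
    with Some show ?thesis
      by (simp add: map_comp_def inv_U U_W)
  qed
  then have "(Some \<circ> U) \<circ>\<^sub>m T\<^sub>1 \<circ>\<^sub>m (Some \<circ> inv U) = T\<^sub>2"
    by (rule ext)
  with unitary_transformationI[OF U_W_adjoint W_U U_W] show ?thesis
    by blast
qed

end
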